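(* Let $n$ be any positive integer. If one of the variables $x_1,\ldots,x_{2n}$ takes the value zero (the others remaining variables), then $S(x_1,\ldots,x_{2n})=0$, i.e., $$\sum_{\tau\in S_{2n}}\ \prod_{\substack{1\le j\le 2n\\ \tau(j)\neq j}}\frac{x_j+x_{\tau(j)}}{x_j-x_{\tau(j)}}=0.$$
   Context: Let $S_{2n}$ be the symmetric group of all permutations of $\{1,\ldots,2n\}$, and let $x_1,\ldots,x_{2n}$ be independent variables. The rational function $S(x_1,\ldots,x_{2n})$ is defined as the permanent of the matrix $[x_{j,k}]_{1\le j,k\le 2n}$, where $x_{j,k}=(x_j+x_k)/(x_j-x_k)$ if $j\neq k$ and $x_{j,j}=1$; this is exactly the sum displayed in the claim. An empty product equals $1$. (The permanent of $[a_{j,k}]_{1\le j,k\le m}$ is $\sum_{\tau\in S_m}\prod_{j=1}^m a_{j,\tau(j)}$.) *)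

theory Defs
  imports
    "HOL-Combinatorics.Permutations"
    "HOL-Library.Poly_Mapping"
    "HOL-Computational_Algebra.Fraction_Field"
begin

text \<open>
  Monomials are finitely supported exponent functions \<open>nat \<Rightarrow>\<^sub>0 nat\<close>, polynomials are finitely
  supported coefficient functions on monomials (multiplication being convolution), and rational
  functions form the fraction field.  There is one variable for each natural number; only those
  with index in \<open>{1..2 * n}\<close> are ever used.
\<close>

type_synonym 'k ratfun = "((nat \<Rightarrow>\<^sub>0 nat) \<Rightarrow>\<^sub>0 'k) fract"

definition Var :: "nat \<Rightarrow> 'k::field ratfun"
  where "Var j = Fraction_Field.Fract (Poly_Mapping.single (Poly_Mapping.single j 1) 1) 1"

definition permanent :: "nat \<Rightarrow> (nat \<Rightarrow> nat \<Rightarrow> 'a::comm_ring_1) \<Rightarrow> 'a"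
  where "permanent m a = (\<Sum>\<tau> | \<tau> permutes {1..m}. \<Prod>j\<in>{1..m}. a j (\<tau> j))"

text \<open>
  The argument \<open>m\<close> is the number of variables (\<open>m = 2 * n\<close> in the intended use).  The definition
  is generic in the field, so that some of the \<open>x j\<close> may be indeterminates and others constants.
\<close>

definition S :: "nat \<Rightarrow> (nat \<Rightarrow> 'a::field) \<Rightarrow> 'a"
  where "S m x = permanent m (\<lambda>j k. if j \<noteq> k then (x j + x k) / (x j - x k) else 1)"

end

theory Submission
  imports Defs
begin

text \<open>
  Put \<open>Y a b = (x a + x b) / (x a - x b)\<close>.  This kernel is antisymmetric off the diagonal and obeys
  the addition law of the cotangent.  Removing a point \<open>z\<close> from its cycle in a permutation and
  summing over all places where \<open>z\<close> can be inserted, the addition law makes the dependence on \<open>z\<close>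
  telescope along the cycles, except for the 2-cycles through \<open>z\<close>.  So the permanent over
  \<open>insert z R\<close> is a term independent of \<open>z\<close> plus the sum of
  \<open>1 - (Y a z)\<^sup>2\<close> times the permanent over \<open>R - {a}\<close>, for \<open>a \<in> R\<close>.  By induction the latter
  permanents vanish if \<open>R\<close> still contains the variable with value zero, so any other variable may be
  replaced by an extremal one, for which all entries are \<open>1\<close> or \<open>-1\<close>.  One ends up with the matrix
  with entries \<open>1\<close> on and below the diagonal and \<open>-1\<close> above.  Its transpose arises from it by a
  cyclic shift of the rows and sign changes in all rows but one, so for even size the permanent
  equals its own negative.
\<close>

section \<open>Permanents over arbitrary index sets\<close>

text \<open>The index set is a parameter because the recursion deletes points and relabels
  them.\<close>

definition permanent_on :: "'b set \<Rightarrow> ('b \<Rightarrow> 'b \<Rightarrow> 'a::comm_ring_1) \<Rightarrow> 'a"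
  where "permanent_on I Y = (\<Sum>\<tau> | \<tau> permutes I. \<Prod>j\<in>I. Y j (\<tau> j))"

lemma permanent_on_cong:
  assumes "\<And>a b. a \<in> I \<Longrightarrow> b \<in> I \<Longrightarrow> Y a b = Z a b"
  shows "permanent_on I Y = permanent_on I Z"
  unfolding permanent_on_def
  by (intro sum.cong prod.cong refl assms) (auto simp: permutes_in_image)

lemma permanent_on_transpose: "permanent_on I Y = permanent_on I (\<lambda>a b. Y b a)"
proof -
  have "(\<Prod>j\<in>I. Y j (inv \<tau> j)) = (\<Prod>j\<in>I. Y (\<tau> j) j)" if "\<tau> permutes I" for \<tau>
    using prod.permute[OF that, of "\<lambda>j. Y j (inv \<tau> j)"] permutes_inverses(2)[OF that]
    by (simp add: o_def)
  then show ?thesis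
    unfolding permanent_on_def by (subst sum_permutations_inverse) (auto intro: sum.cong)
qed

lemma permanent_on_permute_rows:
  assumes "s permutes I"
  shows "permanent_on I (\<lambda>a. Y (s a)) = permanent_on I Y"
proof -
  have "(\<Prod>j\<in>I. Y (s j) (\<tau> (s j))) = (\<Prod>j\<in>I. Y j (\<tau> j))" for \<tau>
    using prod.permute[OF assms, of "\<lambda>j. Y j (\<tau> j)"] by (simp add: o_def)
  then show ?thesis
    unfolding permanent_on_def by (subst sum_permutations_compose_right[OF assms]) simp
qed

lemma permanent_on_scale_rows:
  "permanent_on I (\<lambda>a b. e a * Y a b) = prod e I * permanent_on I Y"
  by (simp add: permanent_on_def prod.distrib sum_distrib_left)

section \<open>Kernels with the cotangent addition law\<close>

text \<open>If x_a = e^(2it_a), then (x_a+x_b)/(x_a-x_b) = -i cot(t_a-t_b), and the last clause is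
  the addition theorem of the cotangent, written with the difference \<open>Y a c - Y b c\<close>
  that telescopes along cycles. Axioms are used instead of quotients because limiting kernels with
  entries 1 and -1 satisfy them too.\<close>

definition cot_kernel :: "'b set \<Rightarrow> ('b \<Rightarrow> 'b \<Rightarrow> 'a::comm_ring_1) \<Rightarrow> bool"
  where "cot_kernel I Y \<longleftrightarrow>
    (\<forall>a\<in>I. Y a a = 1) \<and>
    (\<forall>a\<in>I. \<forall>b\<in>I. a \<noteq> b \<longrightarrow> Y b a = - Y a b) \<and>
    (\<forall>a\<in>I. \<forall>b\<in>I. \<forall>c\<in>I. a \<noteq> b \<longrightarrow> a \<noteq> c \<longrightarrow> b \<noteq> c \<longrightarrow>
       Y a c * Y c b = Y a b * (Y a c - Y b c) - 1)"

lemma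
  assumes "cot_kernel I Y"
  shows cot_kernel_diag: "a \<in> I \<Longrightarrow> Y a a = 1"
    and cot_kernel_antisym: "a \<in> I \<Longrightarrow> b \<in> I \<Longrightarrow> a \<noteq> b \<Longrightarrow> Y b a = - Y a b"
    and cot_kernel_add: "a \<in> I \<Longrightarrow> b \<in> I \<Longrightarrow> c \<in> I \<Longrightarrow> a \<noteq> b \<Longrightarrow> a \<noteq> c \<Longrightarrow> b \<noteq> c \<Longrightarrow>
      Y a c * Y c b = Y a b * (Y a c - Y b c) - 1"
  using assms unfolding cot_kernel_def by blast+

lemma cot_kernel_subset: "cot_kernel I Y \<Longrightarrow> J \<subseteq> I \<Longrightarrow> cot_kernel J Y"
  unfolding cot_kernel_def by (meson subsetD)

section \<open>Inserting and replacing a point\<close>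

lemma permutes_fixing:
  assumes "a \<in> R"
  shows "{p. p permutes R \<and> p a = a} = {p. p permutes (R - {a})}"
proof -
  have "p permutes (R - {a})" if "p permutes R" "p a = a" for p
    using permutes_superset[OF that(1), of "R - {a}"] that(2) by auto
  moreover have "p permutes R \<and> p a = a" if "p permutes (R - {a})" for p
    using permutes_subset[OF that, of R] permutes_not_in[OF that, of a] by auto
  ultimately show ?thesis by blast
qed

text \<open>Each permutation of \<open>insert z R\<close> is uniquely
  \<open>transpose z b \<circ> p\<close> with \<open>p\<close> a permutation of \<open>R\<close>.
  The form isolates the dependence on \<open>z\<close> in the last sum.\<close>

lemma permanent_on_insert:
  fixes Y :: "'b \<Rightarrow> 'b \<Rightarrow> 'a::comm_ring_1"
  assumes fin: "finite R" and z: "z \<notin> R" and Y: "cot_kernel (insert z R) Y"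
  shows "permanent_on (insert z R) Y =
    permanent_on R Y - (\<Sum>p | p permutes R. \<Sum>a\<in>R. \<Prod>j\<in>R - {a}. Y j (p j))
    + (\<Sum>a\<in>R. (1 - (Y a z)\<^sup>2) * permanent_on (R - {a}) Y)"
proof -
  define D where "D p a = (\<Prod>j\<in>R - {a}. Y j (p j))" for p a
  define E where "E p = (\<Prod>j\<in>R. Y j (p j))" for p
  \<comment> \<open>Inserting \<open>z\<close> at a fixed point \<open>a\<close> makes a 2-cycle
    with value \<open>- (Y a z)\<^sup>2\<close>. Writing this as
    \<open>(1 - (Y a z)\<^sup>2) - 1\<close> lets every insertion contribute the same
    \<open>- D p a\<close>.\<close>
  define W where "W p a = (if p a = a then (1 - (Y a z)\<^sup>2) * D p a else 0)" for p a
  have E_D: "E p = Y a (p a) * D p a" if "a \<in> R" for p a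
    unfolding E_def D_def by (rule prod.remove[OF fin that])
  \<comment> \<open>Composing with \<open>transpose z (p a)\<close> puts \<open>z\<close> between
    \<open>a\<close> and \<open>p a\<close> in its cycle.\<close>
  have insertion: "(\<Prod>j\<in>insert z R. Y j ((transpose z (p a) \<circ> p) j))
      = W p a - D p a + E p * (Y a z - Y (p a) z)" if p: "p permutes R" and a: "a \<in> R" for p a
  proof -
    have pz: "p z = z" and pa: "p a \<in> R"
      using p z a by (auto simp: permutes_not_in permutes_in_image)
    have "(\<Prod>j\<in>R - {a}. Y j ((transpose z (p a) \<circ> p) j)) = D p a"
      unfolding D_def
    proof (rule prod.cong[OF refl])
      fix j assume j: "j \<in> R - {a}"
      have "p j \<noteq> p a" using j permutes_inj[OF p] by (auto dest: injD)
      moreover have "p j \<noteq> z" using j z permutes_in_image[OF p, of j] by auto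
      ultimately show "Y j ((transpose z (p a) \<circ> p) j) = Y j (p j)"
        by simp
    qed
    then have "(\<Prod>j\<in>insert z R. Y j ((transpose z (p a) \<circ> p) j)) = Y z (p a) * (Y a z * D p a)"
      using fin z pz by (simp add: prod.remove[OF fin a])
    also have "\<dots> = (Y a z * Y z (p a)) * D p a" by (simp add: ac_simps)
    also have "\<dots> = W p a - D p a + E p * (Y a z - Y (p a) z)"
    proof (cases "p a = a")
      case True
      have "Y z a = - Y a z" using cot_kernel_antisym[OF Y, of a z] a z by auto
      then show ?thesis using True by (simp add: W_def power2_eq_square algebra_simps)
    next
      case False
      have "Y a z * Y z (p a) = Y a (p a) * (Y a z - Y (p a) z) - 1"
        using False a pa z by (intro cot_kernel_add[OF Y]) auto
      show ?thesis
        unfolding \<open>Y a z * Y z (p a) = _\<close> using False by (simp add: W_def E_D[OF a] algebra_simps)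
    qed
    finally show ?thesis .
  qed
  have all_insertions: "(\<Sum>b\<in>insert z R. \<Prod>j\<in>insert z R. Y j ((transpose z b \<circ> p) j))
      = E p + (\<Sum>a\<in>R. W p a) - (\<Sum>a\<in>R. D p a)" if p: "p permutes R" for p
  proof -
    have "(\<Prod>j\<in>insert z R. Y j ((transpose z z \<circ> p) j)) = E p"
      using fin z p cot_kernel_diag[OF Y, of z] by (simp add: E_def permutes_not_in)
    moreover have "(\<Sum>b\<in>R. \<Prod>j\<in>insert z R. Y j ((transpose z b \<circ> p) j))
        = (\<Sum>a\<in>R. \<Prod>j\<in>insert z R. Y j ((transpose z (p a) \<circ> p) j))"
      by (subst sum.permute[OF p]) (simp add: o_def)
    moreover have "\<dots> = (\<Sum>a\<in>R. W p a) - (\<Sum>a\<in>R. D p a)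
        + E p * ((\<Sum>a\<in>R. Y a z) - (\<Sum>a\<in>R. Y (p a) z))"
      using insertion[OF p]
      by (simp add: sum.distrib sum_subtractf flip: sum_distrib_left)
    \<comment> \<open>The telescoping: \<open>p\<close> only rearranges the summands.\<close>
    moreover have "(\<Sum>a\<in>R. Y (p a) z) = (\<Sum>a\<in>R. Y a z)"
      using sum.permute[OF p, of "\<lambda>a. Y a z"] by (simp add: o_def)
    ultimately show ?thesis
      using fin z by simp
  qed
  have "(\<Sum>p | p permutes R. W p a) = (1 - (Y a z)\<^sup>2) * permanent_on (R - {a}) Y"
    if a: "a \<in> R" for a
  proof -
    have "(\<Sum>p | p permutes R. W p a)
        = (\<Sum>p | p permutes R \<and> p a = a. (1 - (Y a z)\<^sup>2) * D p a)"
      unfolding W_def by (simp add: finite_permutations[OF fin] flip: sum.inter_filter)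
    then show ?thesis
      unfolding permutes_fixing[OF a] permanent_on_def D_def by (simp add: sum_distrib_left)
  qed
  then have W_sum: "(\<Sum>p | p permutes R. \<Sum>a\<in>R. W p a)
      = (\<Sum>a\<in>R. (1 - (Y a z)\<^sup>2) * permanent_on (R - {a}) Y)"
    by (subst sum.swap) simp
  have "permanent_on (insert z R) Y = (\<Sum>p | p permutes R.
      \<Sum>b\<in>insert z R. \<Prod>j\<in>insert z R. Y j ((transpose z b \<circ> p) j))"
    unfolding permanent_on_def sum_over_permutations_insert[OF fin z] by (rule sum.swap)
  also have "\<dots> = (\<Sum>p | p permutes R. E p + (\<Sum>a\<in>R. W p a) - (\<Sum>a\<in>R. D p a))"
    using all_insertions by (intro sum.cong) auto
  also have "\<dots> = permanent_on R Y - (\<Sum>p | p permutes R. \<Sum>a\<in>R. D p a)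
      + (\<Sum>a\<in>R. (1 - (Y a z)\<^sup>2) * permanent_on (R - {a}) Y)"
    unfolding W_sum[symmetric] by (simp add: sum.distrib sum_subtractf permanent_on_def E_def)
  finally show ?thesis unfolding D_def .
qed

text \<open>In \<open>permanent_on_insert\<close> the first two terms involve only entries between
  points of \<open>R\<close>, where the kernels agree; the last sums vanish by assumption. The new
  point may carry a different label.\<close>

lemma permanent_on_replace:
  fixes Y Z :: "'b \<Rightarrow> 'b \<Rightarrow> 'a::comm_ring_1"
  assumes fin: "finite R" and z: "z \<notin> R" "z' \<notin> R"
    and Y: "cot_kernel (insert z R) Y" and Z: "cot_kernel (insert z' R) Z"
    and eq: "\<And>a b. a \<in> R \<Longrightarrow> b \<in> R \<Longrightarrow> Y a b = Z a b"
    and Y0: "\<And>a. a \<in> R \<Longrightarrow> (1 - (Y a z)\<^sup>2) * permanent_on (R - {a}) Y = 0"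
    and Z0: "\<And>a. a \<in> R \<Longrightarrow> (1 - (Z a z')\<^sup>2) * permanent_on (R - {a}) Z = 0"
  shows "permanent_on (insert z R) Y = permanent_on (insert z' R) Z"
proof -
  have "permanent_on R Y = permanent_on R Z"
    by (rule permanent_on_cong) (rule eq)
  moreover have "(\<Sum>p | p permutes R. \<Sum>a\<in>R. \<Prod>j\<in>R - {a}. Y j (p j))
      = (\<Sum>p | p permutes R. \<Sum>a\<in>R. \<Prod>j\<in>R - {a}. Z j (p j))"
    by (intro sum.cong prod.cong refl eq) (auto simp: permutes_in_image)
  ultimately show ?thesis
    unfolding permanent_on_insert[OF fin z(1) Y] permanent_on_insert[OF fin z(2) Z]
    using Y0 Z0 by simp
qed

section \<open>The sign matrix\<close>

text \<open>This is the cyclic row shift. Its last property trades strict for non-strict comparison,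
  as is needed to match a row of the sign matrix with a row of its transpose.\<close>

lemma cyclic_predecessor:
  fixes I :: "'b::linorder set"
  assumes fin: "finite I" and ne: "I \<noteq> {}"
  obtains s where "s permutes I" "s (Min I) = Max I"
    "\<And>a b. a \<in> I \<Longrightarrow> a \<noteq> Min I \<Longrightarrow> b \<in> I \<Longrightarrow> b \<le> s a \<longleftrightarrow> b < a"
proof -
  define s where "s a = (if a \<notin> I then a else if a = Min I then Max I else Max {b \<in> I. b < a})" for a
  have s_Min: "s (Min I) = Max I"
    using Min_in[OF fin ne] by (simp add: s_def)
  have pred: "s a \<in> I \<and> s a < a \<and> (\<forall>b\<in>I. b \<le> s a \<longleftrightarrow> b < a)"
    if a: "a \<in> I" "a \<noteq> Min I" for a
  proof -
    have fin': "finite {b \<in> I. b < a}" using fin by simp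
    have "Min I < a" using a Min_le[OF fin a(1)] by simp
    then have "{b \<in> I. b < a} \<noteq> {}" using Min_in[OF fin ne] by blast
    from Max_in[OF fin' this] Max_ge[OF fin'] have "s a \<in> I" "s a < a" "\<forall>b\<in>I. b < a \<longrightarrow> b \<le> s a"
      using a by (simp_all add: s_def)
    then show ?thesis by auto
  qed
  have into: "s a \<in> I" if "a \<in> I" for a
    using pred[OF that] s_Min Max_in[OF fin ne] by (cases "a = Min I") auto
  \<comment> \<open>If \<open>Min I\<close> is counted as the largest point, \<open>s\<close> is
    strictly increasing, hence injective.\<close>
  have less: "s a' < s a" if "a \<in> I" "a' \<in> I" "a' \<noteq> Min I" "a = Min I \<or> a' < a" for a a'
  proof (cases "a = Min I")
    case True
    have "s a' < a'" using pred that by blast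
    also have "a' \<le> Max I" using Max_ge[OF fin] that by blast
    finally show ?thesis using True s_Min by simp
  next
    case False
    then have "a' \<le> s a" using pred[of a] that by blast
    moreover have "s a' < a'" using pred that by blast
    ultimately show ?thesis by simp
  qed
  have "inj_on s I"
  proof (rule inj_onI, rule ccontr)
    fix a b assume ab: "a \<in> I" "b \<in> I" "s a = s b" "a \<noteq> b"
    show False
      using less[of a b] less[of b a] ab by (metis less_irrefl linorder_neqE)
  qed
  then have "bij_betw s I I"
    using into fin by (intro bij_betw_imageI endo_inj_surj) auto
  then have "s permutes I"
    by (rule bij_imp_permutes) (simp add: s_def)
  then show ?thesis using that s_Min pred by blast
qed

lemma permanent_on_sign_matrix:
  fixes Y :: "'b::linorder \<Rightarrow> 'b \<Rightarrow> 'a::field"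
  assumes two: "(2::'a) \<noteq> 0" and fin: "finite I" and ne: "I \<noteq> {}" and even: "even (card I)"
    and Y: "\<And>a b. a \<in> I \<Longrightarrow> b \<in> I \<Longrightarrow> Y a b = (if a < b then - 1 else 1)"
  shows "permanent_on I Y = 0"
proof -
  obtain s where s: "s permutes I" "s (Min I) = Max I"
    "\<And>a b. a \<in> I \<Longrightarrow> a \<noteq> Min I \<Longrightarrow> b \<in> I \<Longrightarrow> b \<le> s a \<longleftrightarrow> b < a"
    using cyclic_predecessor[OF fin ne] by blast
  define e :: "'b \<Rightarrow> 'a" where "e a = (if a = Min I then 1 else - 1)" for a
  have "Y b a = e a * Y (s a) b" if a: "a \<in> I" and b: "b \<in> I" for a b
  proof -
    have sa: "s a \<in> I" using a s(1) by (simp add: permutes_in_image)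
    show ?thesis
    proof (cases "a = Min I")
      case True
      \<comment> \<open>The column of \<open>Min I\<close> and the row of \<open>Max I\<close> are
        both constantly 1, so this row keeps its sign.\<close>
      have "\<not> b < Min I" "\<not> Max I < b" using b fin by (auto simp: not_less)
      then show ?thesis using True Y[OF b a] Y[OF sa b] s(2) by (simp add: e_def)
    next
      case False
      then show ?thesis using Y[OF b a] Y[OF sa b] s(3)[OF a False b]
        by (auto simp: e_def not_less[symmetric])
    qed
  qed
  then have "permanent_on I Y = permanent_on I (\<lambda>a b. e a * Y (s a) b)"
    by (subst permanent_on_transpose) (rule permanent_on_cong)
  also have "\<dots> = prod e I * permanent_on I Y"
    by (simp add: permanent_on_scale_rows permanent_on_permute_rows[OF s(1)])
  also have "prod e I = - 1"
  proof -
    have "prod e I = (\<Prod>a\<in>I - {Min I}. - 1)"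
      using prod.remove[OF fin Min_in[OF fin ne], of e]
      by (simp add: e_def)
    also have "\<dots> = (- 1) ^ (card I - 1)"
      using fin ne by (simp add: card_Diff_singleton)
    also have "odd (card I - 1)"
      using even fin ne by (simp add: card_gt_0_iff)
    then have "(- 1) ^ (card I - 1) = (- 1 :: 'a)" by simp
    finally show ?thesis .
  qed
  finally have "2 * permanent_on I Y = 0" by simp
  then show ?thesis using two by simp
qed

section \<open>Making the points extremal one by one\<close>

text \<open>\<open>Z\<close> is the limit in which x_k becomes negligible against all later points,
  those before \<open>k\<close> being already negligible. In a triple containing \<open>k\<close>
  the least point is at most \<open>k\<close>, so its entries with the other two are 1 or -1; the
  remaining entry then cancels from the addition law.\<close>

lemma cot_kernel_extremal:
  fixes Y :: "'b::linorder \<Rightarrow> 'b \<Rightarrow> 'a::comm_ring_1"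
  assumes Y: "cot_kernel I Y"
    and low: "\<And>a b. a \<in> I \<Longrightarrow> b \<in> I \<Longrightarrow> a < k \<Longrightarrow> a < b \<Longrightarrow> Y a b = - 1"
    and Z: "\<And>a b. Z a b = (if a = k \<and> k < b then - 1 else if b = k \<and> k < a then 1 else Y a b)"
  shows "cot_kernel I Z"
proof -
  note anti = cot_kernel_antisym[OF Y]
  have diag: "Z a a = 1" if "a \<in> I" for a
    using that cot_kernel_diag[OF Y] by (auto simp: Z)
  have anti_Z: "Z b a = - Z a b" if "a \<in> I" "b \<in> I" "a \<noteq> b" for a b
    using that anti[OF that] by (auto simp: Z)
  have low_Z: "Z a b = - 1" if "a \<in> I" "b \<in> I" "a \<le> k" "a < b" for a b
    using that low[of a b] by (cases "a = k") (auto simp: Z)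
  have low_Z': "Z b a = 1" if "a \<in> I" "b \<in> I" "a \<le> k" "a < b" for a b
    using low_Z[OF that] anti_Z[of a b] that by auto
  have add: "Z a c * Z c b = Z a b * (Z a c - Z b c) - 1"
    if abc: "a \<in> I" "b \<in> I" "c \<in> I" "a \<noteq> b" "a \<noteq> c" "b \<noteq> c" for a b c
  proof (cases "k \<in> {a, b, c}")
    case False
    then have "a \<noteq> k" "b \<noteq> k" "c \<noteq> k" by auto
    then show ?thesis using cot_kernel_add[OF Y abc] by (simp only: Z) auto
  next
    case True
    consider "a < b" "a < c" | "b < a" "b < c" | "c < a" "c < b"
      using abc by (metis linorder_neqE order.strict_trans)
    then show ?thesis
    proof cases
      case 1
      then have "a \<le> k" using True by auto
      then show ?thesis using 1 abc low_Z[of a b] low_Z[of a c] anti_Z[of b c] by auto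
    next
      case 2
      then have "b \<le> k" using True by auto
      then show ?thesis using 2 abc low_Z'[of b a] low_Z[of b c] low_Z'[of b c] by auto
    next
      case 3
      then have "c \<le> k" using True by auto
      then show ?thesis using 3 abc low_Z'[of c a] low_Z'[of c b] low_Z[of c b] by auto
    qed
  qed
  show ?thesis
    unfolding cot_kernel_def using diag anti_Z add by blast
qed

text \<open>The condition on \<open>Min I\<close> expresses that this point carries the value zero.
  An outer induction on the size removes the correction terms; an inner one makes the points
  extremal in increasing order until the sign matrix is reached.\<close>

lemma permanent_on_eq_0:
  fixes Y :: "nat \<Rightarrow> nat \<Rightarrow> 'a::field"
  assumes "(2::'a) \<noteq> 0" "finite I" "I \<noteq> {}" "even (card I)" "cot_kernel I Y"
    and "\<And>b. b \<in> I \<Longrightarrow> b \<noteq> Min I \<Longrightarrow> Y (Min I) b = - 1"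
  shows "permanent_on I Y = 0"
  using assms
proof (induction "card I" arbitrary: I Y rule: less_induct)
  case less
  note two = less.prems(1) and fin = less.prems(2) and ne = less.prems(3) and even = less.prems(4)
  define l where "l = Min I"
  have l: "l \<in> I" and l_le: "\<And>a. a \<in> I \<Longrightarrow> l \<le> a"
    unfolding l_def using fin ne by auto
  \<comment> \<open>Deleting two points above \<open>l\<close> keeps the size even and
    \<open>l\<close> the minimum, so the outer induction applies.\<close>
  have smaller: "permanent_on (I - {k} - {b}) Y = 0"
    if Y: "cot_kernel I Y" and Y_l: "\<And>b. b \<in> I \<Longrightarrow> l < b \<Longrightarrow> Y l b = - 1"
      and k: "k \<in> I" "l < k" and b: "b \<in> I" "k < b" for Y :: "nat \<Rightarrow> nat \<Rightarrow> 'a" and k b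
  proof (rule less.hyps)
    have card: "card (I - {k} - {b}) = card I - 2"
      using k b fin by (simp add: card_Diff_singleton)
    have "card I > 0" using fin ne by (simp add: card_gt_0_iff)
    then show "card (I - {k} - {b}) < card I" using card by simp
    show "even (card (I - {k} - {b}))" using card even by simp
    have Min: "Min (I - {k} - {b}) = l"
      using fin l l_le k b by (intro Min_eqI) auto
    show "Y (Min (I - {k} - {b})) c = - 1"
      if "c \<in> I - {k} - {b}" "c \<noteq> Min (I - {k} - {b})" for c
      unfolding Min using that Min l_le[of c] by (intro Y_l) auto
    show "I - {k} - {b} \<noteq> {}" using l k b by auto
    show "cot_kernel (I - {k} - {b}) Y" using Y by (rule cot_kernel_subset) auto
  qed (use two fin in auto)
  \<comment> \<open>At \<open>k = m\<close> all points lie below \<open>k\<close>, so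
    \<open>Y\<close> is the sign matrix.\<close>
  define m where "m = Suc (Max I)"
  have m: "a < m" if "a \<in> I" for a
    using that fin by (simp add: m_def less_Suc_eq_le)
  have partial: "permanent_on I Y = 0"
    if "k \<le> m" "l < k" "cot_kernel I Y"
      and "\<And>a b. a \<in> I \<Longrightarrow> b \<in> I \<Longrightarrow> a < k \<Longrightarrow> a < b \<Longrightarrow> Y a b = - 1"
    for k and Y :: "nat \<Rightarrow> nat \<Rightarrow> 'a"
    using that
  \<comment> \<open>The induction runs downwards from \<open>m\<close>: the claim for
    \<open>k\<close> is reduced to that for \<open>Suc k\<close> by making \<open>k\<close>
    extremal.\<close>
  proof (induction k arbitrary: Y rule: inc_induct)
    case base
    then have sign: "Y a b = - 1" if "a \<in> I" "b \<in> I" "a < b" for a b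
      using that m by blast
    show ?case
    proof (rule permanent_on_sign_matrix[OF two fin ne even])
      fix a b assume ab: "a \<in> I" "b \<in> I"
      show "Y a b = (if a < b then - 1 else 1)"
      proof (cases a b rule: linorder_cases)
        case less
        then show ?thesis using sign[OF ab] by simp
      next
        case equal
        then show ?thesis using cot_kernel_diag[OF base.prems(2) ab(1)] by simp
      next
        case greater
        then have "Y a b = - (- 1)"
          using sign[OF ab(2,1)] cot_kernel_antisym[OF base.prems(2) ab(2,1)] by simp
        then show ?thesis using greater by simp
      qed
    qed
  next
    case (step k)
    note Y = step.prems(2) and low = step.prems(3)
    define Z where "Z a b = (if a = k \<and> k < b then - 1 else if b = k \<and> k < a then 1 else Y a b)"
      for a b
    have Z: "cot_kernel I Z"
      using Y low by (rule cot_kernel_extremal) (auto simp: Z_def)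
    have low_Z: "Z a b = - 1" if "a \<in> I" "b \<in> I" "a < Suc k" "a < b" for a b
      using that low[of a b] by (cases "a = k") (auto simp: Z_def)
    have "permanent_on I Z = 0"
      using step.IH[OF _ Z low_Z] step.prems(1) by simp
    moreover have "permanent_on I Y = permanent_on I Z"
    proof (cases "k \<in> I")
      case False
      then show ?thesis by (intro permanent_on_cong) (auto simp: Z_def)
    next
      case True
      \<comment> \<open>For \<open>a < k\<close> the factor vanishes since the entry is -1; for
        \<open>a > k\<close> the smaller permanent vanishes. Both kernels \<open>Y\<close> and
        \<open>Z\<close> qualify for \<open>X\<close>.\<close>
      have kill: "(1 - (X a k)\<^sup>2) * permanent_on (I - {k} - {a}) X = 0"
        if a: "a \<in> I - {k}" and X: "cot_kernel I X"
          and low: "\<And>a b. a \<in> I \<Longrightarrow> b \<in> I \<Longrightarrow> a < k \<Longrightarrow> a < b \<Longrightarrow> X a b = - 1"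
        for a and X :: "nat \<Rightarrow> nat \<Rightarrow> 'a"
      proof (cases "a < k")
        case True
        then have "X a k = - 1" using low[of a k] a \<open>k \<in> I\<close> by auto
        then show ?thesis by simp
      next
        case False
        then have "k < a" "a \<in> I" using a by auto
        moreover have "X l b = - 1" if "b \<in> I" "l < b" for b
          using low[OF l] that step.prems(1) by blast
        ultimately have "permanent_on (I - {k} - {a}) X = 0"
          using smaller[OF X] \<open>k \<in> I\<close> step.prems(1) by blast
        then show ?thesis by simp
      qed
      have I: "insert k (I - {k}) = I" using True by auto
      have "permanent_on (insert k (I - {k})) Y = permanent_on (insert k (I - {k})) Z"
      proof (rule permanent_on_replace)
        show "(1 - (Y a k)\<^sup>2) * permanent_on (I - {k} - {a}) Y = 0" if "a \<in> I - {k}" for a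
          using kill[OF that Y low] .
        show "(1 - (Z a k)\<^sup>2) * permanent_on (I - {k} - {a}) Z = 0" if "a \<in> I - {k}" for a
          using kill[OF that Z] low_Z by simp
      qed (use fin Y Z I in \<open>auto simp: Z_def\<close>)
      then show ?thesis unfolding I .
    qed
    ultimately show ?case by simp
  qed
  show ?case
  proof (rule partial)
    \<comment> \<open>The start is \<open>k = Suc l\<close>: only \<open>l\<close> has to be
      extremal.\<close>
    show "Suc l \<le> m" using m[OF l] by simp
    show "Y a b = - 1" if "a \<in> I" "b \<in> I" "a < Suc l" "a < b" for a b
      using that l_le[of a] less.prems(6)[of b] by (auto simp: l_def[symmetric] less_Suc_eq)
  qed (use less.prems in auto)
qed

section \<open>The quotient kernel and the vanishing of \<open>S\<close>\<close>

lemma cot_kernel_quotient: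
  fixes x :: "nat \<Rightarrow> 'a::field"
  assumes "inj_on x I"
  shows "cot_kernel I (\<lambda>a b. if a \<noteq> b then (x a + x b) / (x a - x b) else 1)"
proof -
  have neq: "x a - x b \<noteq> 0" if "a \<in> I" "b \<in> I" "a \<noteq> b" for a b
    using assms that by (auto dest: inj_onD)
  have anti: "(x b + x a) / (x b - x a) = - ((x a + x b) / (x a - x b))"
    if "a \<in> I" "b \<in> I" "a \<noteq> b" for a b
    using neq[OF that] neq[OF that(2,1)] that(3) by (simp add: field_simps)
  have add: "(x a + x c) / (x a - x c) * ((x c + x b) / (x c - x b)) =
      (x a + x b) / (x a - x b) * ((x a + x c) / (x a - x c) - (x b + x c) / (x b - x c)) - 1"
    if "a \<in> I" "b \<in> I" "c \<in> I" "a \<noteq> b" "a \<noteq> c" "b \<noteq> c" for a b c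
  proof -
    have nz: "x a - x b \<noteq> 0" "x a - x c \<noteq> 0" "x b - x c \<noteq> 0" "x c - x b = - (x b - x c)"
      using neq that by auto
    have "(x a + x c) * (x c + x b) * (x a - x b) =
        (x a - x b) * (x a - x c) * (x b - x c)
        - (x a + x b) * ((x a + x c) * (x b - x c) - (x b + x c) * (x a - x c))"
      by algebra
    then have num: "(x a + x b) * ((x a + x c) * (x b - x c) - (x b + x c) * (x a - x c))
        - (x a - x b) * (x a - x c) * (x b - x c) = - ((x a + x c) * (x c + x b) * (x a - x b))"
      by simp
    \<comment> \<open>With generic denominators \<open>p\<close>, \<open>q\<close>, \<open>r\<close>
      in place of the three differences, both sides get the common denominator
      \<open>p * q * r\<close>, and only the polynomial identity \<open>num\<close> remains.\<close>
    have frac: "B / p * (A / q - E / r) - 1 = (B * (A * r - E * q) - p * q * r) / (p * q * r)"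
      and frac': "A / q * (C / - r) = - (A * C * p) / (p * q * r)"
      if "p \<noteq> 0" "q \<noteq> 0" "r \<noteq> 0" for A B C E p q r :: 'a
      using that by (simp_all add: field_simps)
    show ?thesis unfolding nz(4) frac[OF nz(1-3)] frac'[OF nz(1-3)] num ..
  qed
  show ?thesis
    unfolding cot_kernel_def
  proof (intro conjI ballI impI, goal_cases)
    case (2 a b)
    then show ?case using anti[of a b] by simp
  next
    case (3 a b c)
    then show ?case using add[of a b c] by simp
  qed simp
qed

text \<open>Distinctness of the values makes all denominators nonzero, which yields a cotangent
  kernel.\<close>

lemma S_eq_0:
  fixes x :: "nat \<Rightarrow> 'a::field"
  assumes two: "(2::'a) \<noteq> 0" and i: "i \<in> {1..2 * n}" and xi: "x i = 0"
    and inj: "inj_on x {1..2 * n}"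
  shows "S (2 * n) x = 0"
proof -
  define R where "R = {1..2 * n} - {i}"
  \<comment> \<open>Relabelling the point \<open>i\<close> as \<open>0\<close> makes the vanishing variable the least one.\<close>
  define x' where "x' = x(0 := 0)"
  define Y where "Y a b = (if a \<noteq> b then (x a + x b) / (x a - x b) else 1)" for a b
  define Y' where "Y' a b = (if a \<noteq> b then (x' a + x' b) / (x' a - x' b) else 1)" for a b
  have R: "insert i R = {1..2 * n}" "0 \<notin> R" "i \<notin> R" "finite R" using i by (auto simp: R_def)
  have nz: "x a \<noteq> 0" if "a \<in> R" for a
    using that inj i xi by (metis DiffE R_def inj_onD insertI1)
  have Y: "cot_kernel (insert i R) Y"
    unfolding Y_def R(1) using inj by (rule cot_kernel_quotient)
  have "inj_on x R" using inj by (rule inj_on_subset) (auto simp: R_def)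
  then have "inj_on x' (insert 0 R)"
    using nz R(2) by (auto simp: x'_def inj_on_def)
  then have Y': "cot_kernel (insert 0 R) Y'"
    unfolding Y'_def by (rule cot_kernel_quotient)
  have "S (2 * n) x = permanent_on (insert i R) Y"
    by (simp add: S_def permanent_def permanent_on_def Y_def R(1))
  also have "\<dots> = permanent_on (insert 0 R) Y'"
  proof (rule permanent_on_replace)
    \<comment> \<open>The entry against a zero variable is 1, so the factor vanishes
      outright.\<close>
    show "(1 - (Y a i)\<^sup>2) * permanent_on (R - {a}) Y = 0" if "a \<in> R" for a
      using that R nz[OF that] xi by (auto simp: Y_def)
    show "(1 - (Y' a 0)\<^sup>2) * permanent_on (R - {a}) Y' = 0" if "a \<in> R" for a
      using that R nz[OF that] by (auto simp: Y'_def x'_def)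
    show "Y a b = Y' a b" if "a \<in> R" "b \<in> R" for a b
      using that R(2) by (cases "a = 0"; cases "b = 0") (auto simp: Y_def Y'_def x'_def)
  qed (use R Y Y' in auto)
  also have "\<dots> = 0"
  proof (rule permanent_on_eq_0[OF two])
    have Min: "Min (insert 0 R) = 0" using R(4) by (intro Min_eqI) auto
    show "Y' (Min (insert 0 R)) b = - 1" if "b \<in> insert 0 R" "b \<noteq> Min (insert 0 R)" for b
      unfolding Min using that[unfolded Min] nz[of b] by (auto simp: Y'_def x'_def)
    have "card (insert 0 R) = 2 * n"
      using R(1-4) i by (simp add: R_def)
    then show "even (card (insert 0 R))" by simp
  qed (use R Y' in auto)
  finally show ?thesis .
qed

lemma S_eq_sum:
  "S m x = (\<Sum>\<tau> | \<tau> permutes {1..m}.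
     \<Prod>j | j \<in> {1..m} \<and> \<tau> j \<noteq> j. (x j + x (\<tau> j)) / (x j - x (\<tau> j)))"
  unfolding S_def permanent_def
proof (rule sum.cong[OF refl])
  fix \<tau>
  show "(\<Prod>j\<in>{1..m}. if j \<noteq> \<tau> j then (x j + x (\<tau> j)) / (x j - x (\<tau> j)) else 1) =
    (\<Prod>j | j \<in> {1..m} \<and> \<tau> j \<noteq> j. (x j + x (\<tau> j)) / (x j - x (\<tau> j)))"
    by (rule prod.mono_neutral_cong_right) auto
qed

section \<open>The variables as rational functions\<close>

lemma single_one_eq_iff:
  "Poly_Mapping.single j (1 :: 'b::zero_neq_one) = Poly_Mapping.single k 1 \<longleftrightarrow> j = k"
  by (metis lookup_single_eq lookup_single_not_eq zero_neq_one)

lemma Var_eq_iff: "(Var j :: 'k::field ratfun) = Var k \<longleftrightarrow> j = k"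
  by (simp add: Var_def eq_fract single_one_eq_iff del: One_nat_def)

lemma Var_neq_0: "(Var j :: 'k::field ratfun) \<noteq> 0"
proof
  assume "(Var j :: 'k ratfun) = 0"
  then have "Poly_Mapping.single (Poly_Mapping.single j 1) 1 = (0 :: (nat \<Rightarrow>\<^sub>0 nat) \<Rightarrow>\<^sub>0 'k)"
    by (simp add: Var_def Zero_fract_def eq_fract)
  then show False
    by (metis lookup_single_eq lookup_zero zero_neq_one)
qed

text \<open>This permits the conclusion from a permanent being its own negative to its being
  zero.\<close>

lemma two_ratfun_neq_0: "(2 :: 'k::field_char_0 ratfun) \<noteq> 0"
proof -
  have "of_nat 2 \<noteq> (0 :: 'k ratfun)"
    unfolding of_nat_fract Zero_fract_def by (subst eq_fract(1)) simp_all
  then show ?thesis by simp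
qed

text \<open>The variables are pairwise distinct and nonzero, so setting one of them to zero creates
  no coincidence.\<close>

lemma inj_on_Var_zero:
  fixes x :: "nat \<Rightarrow> 'k::field ratfun"
  assumes "x i = 0" and "\<And>j. j \<in> J \<Longrightarrow> j \<noteq> i \<Longrightarrow> x j = Var j"
  shows "inj_on x J"
proof (rule inj_onI)
  fix a b assume ab: "a \<in> J" "b \<in> J" and eq: "x a = x b"
  have x: "x j = (if j = i then 0 else Var j)" if "j \<in> J" for j
    using assms that by simp
  show "a = b"
    using eq unfolding x[OF ab(1)] x[OF ab(2)]
    by (auto simp: Var_eq_iff Var_neq_0 Var_neq_0[symmetric] split: if_splits)
qed

theorem mainTheorem2:
  fixes n i :: nat
    and x :: "nat \<Rightarrow> 'k::field_char_0 ratfun"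
  assumes "n \<ge> 1"
    and "i \<in> {1..2 * n}"
    and "x i = 0"
    and "\<And>j. j \<in> {1..2 * n} \<Longrightarrow> j \<noteq> i \<Longrightarrow> x j = Var j"
  shows "S (2 * n) x = 0 \<and>
    (\<Sum>\<tau> | \<tau> permutes {1..2 * n}.
      \<Prod>j | j \<in> {1..2 * n} \<and> \<tau> j \<noteq> j. (x j + x (\<tau> j)) / (x j - x (\<tau> j))) = 0"
  unfolding S_eq_sum[symmetric]
  using S_eq_0[OF two_ratfun_neq_0 assms(2,3) inj_on_Var_zero[OF assms(3,4)]] by simp

end
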